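(* Let $n\ge 1$. Snort played on each of the following (initially uncoloured, untinted) graphs is a first player win: $T_{n,3}$; and the graphs obtained from $T_{n,3}$ by adding new vertices and edges as follows: (a) vertices $L_1,R_2,R_3$ with edges $L_1\sim(1,1)$, $L_1\sim(1,2)$, $(n,1)\sim R_2$, $(n,2)\sim R_2$, $(n,2)\sim R_3$, $(n,3)\sim R_3$, $R_2\sim R_3$; (b) vertices $L_1,R_3$ with edges $L_1\sim(1,1)$, $L_1\sim(1,2)$, $(n,2)\sim R_3$, $(n,3)\sim R_3$; (c) vertices $L_1,L_2,R_2,R_3$ with edges $L_1\sim(1,1)$, $L_1\sim(1,2)$, $L_2\sim(1,2)$, $L_2\sim(1,3)$, $L_1\sim L_2$, $(n,1)\sim R_2$, $(n,2)\sim R_2$, $(n,2)\sim R_3$, $(n,3)\sim R_3$, $R_2\sim R_3$; (d) vertices $R_2,R_3,R_3'$ with edges $(n,1)\sim R_2$, $(n,2)\sim R_2$, $(n,2)\sim R_3$, $(n,3)\sim R_3$, $R_2\sim R_3$, $R_2\sim R_3'$, $R_3\sim R_3'$; (e) vertex $R_3$ with edges $(n,2)\sim R_3$, $(n,3)\sim R_3$; (f) when $n$ is even: vertices $R_2,R_3$ with edges $(n,1)\sim R_2$, $(n,2)\sim R_2$, $(n,2)\sim R_3$, $(n,3)\sim R_3$, $R_2\sim R_3$.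
   Context: Snort is a two-player game (players Left and Right) played on a finite simple graph. The players alternately colour a previously uncoloured vertex, Left in blue and Right in red, subject to the rule that no two adjacent vertices may receive opposite colours. Normal play: a player who cannot move on their turn loses. A game is a "first player win" if the player who moves first has a winning strategy, regardless of whether that player is Left or Right. $T_{n,3}$ is the graph with vertex set $\{(i,j): 1\le i\le n,\ 1\le j\le 3\}$ and edges $(i,j)\sim(i+1,j)$ for $1\le i\le n-1$, $1\le j\le 3$; $(i,j)\sim(i,j+1)$ for $1\le i\le n$, $1\le j\le 2$; and $(i,j)\sim(i+1,j+1)$ for $1\le i\le n-1$, $1\le j\le 2$. *)

theory Defs
  imports "Graph_Theory.Pair_Digraph"
begin

text \<open>
  A finite simple graph is a \<open>pair_graph\<close>: a finite, loop-free digraph whose arc set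
  \<open>parcs\<close> is symmetric.  A colour is identified with the player using it, so
  \<open>Some Left\<close> stands for blue, \<open>Some Right\<close> for red and \<open>None\<close> for uncoloured.
\<close>

datatype player = Left | Right

fun opponent :: "player \<Rightarrow> player" where
  "opponent Left = Right"
| "opponent Right = Left"

type_synonym 'v colouring = "'v \<Rightarrow> player option"

definition legal :: "'v pair_pre_digraph \<Rightarrow> player \<Rightarrow> 'v colouring \<Rightarrow> 'v \<Rightarrow> bool" where
  "legal G p c v \<longleftrightarrow>
     v \<in> pverts G \<and> c v = None \<and> (\<forall>w. (v, w) \<in> parcs G \<longrightarrow> c w \<noteq> Some (opponent p))"

definition move :: "player \<Rightarrow> 'v \<Rightarrow> 'v colouring \<Rightarrow> 'v colouring" where
  "move p v c = c(v := Some p)"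

text \<open>
  A strategy maps the current colouring to the vertex to be coloured.  The set of colourings
  that can be on the board when \<open>p\<close> is to move, if \<open>p\<close> starts from the uncoloured
  graph and follows the strategy \<open>s\<close>:
\<close>

inductive_set turns ::
    "'v pair_pre_digraph \<Rightarrow> player \<Rightarrow> ('v colouring \<Rightarrow> 'v) \<Rightarrow> 'v colouring set"
  for G p s where
  start: "(\<lambda>_. None) \<in> turns G p s"
| round: "\<lbrakk>c \<in> turns G p s; legal G p c (s c); legal G (opponent p) (move p (s c) c) w\<rbrakk>
    \<Longrightarrow> move (opponent p) w (move p (s c) c) \<in> turns G p s"

text \<open>
  On a finite graph every play ends, with the loss of the player who is then unable to move.
  Hence \<open>s\<close> wins for \<open>p\<close> iff, whatever the opponent does, it gives \<open>p\<close> a legal move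
  at each of \<open>p\<close>'s turns.
\<close>

definition winning_strategy ::
    "'v pair_pre_digraph \<Rightarrow> player \<Rightarrow> ('v colouring \<Rightarrow> 'v) \<Rightarrow> bool" where
  "winning_strategy G p s \<longleftrightarrow> (\<forall>c \<in> turns G p s. legal G p c (s c))"

definition snort_first_player_win :: "'v pair_pre_digraph \<Rightarrow> bool" where
  "snort_first_player_win G \<longleftrightarrow> (\<forall>p. \<exists>s. winning_strategy G p s)"


datatype vertex = V nat nat | L1 | L2 | R2 | R3 | R3'

text \<open>Here \<open>E\<close> lists every undirected edge in one arbitrary orientation.\<close>

definition add_to_graph ::
    "'v pair_pre_digraph \<Rightarrow> 'v set \<Rightarrow> ('v \<times> 'v) set \<Rightarrow> 'v pair_pre_digraph" where
  "add_to_graph G W E = \<lparr>pverts = pverts G \<union> W, parcs = parcs G \<union> E \<union> E\<inverse>\<rparr>"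

definition T3_edges :: "nat \<Rightarrow> (vertex \<times> vertex) set" where
  "T3_edges n =
     {(V i j, V (i + 1) j) | i j. 1 \<le> i \<and> i + 1 \<le> n \<and> 1 \<le> j \<and> j \<le> 3} \<union>
     {(V i j, V i (j + 1)) | i j. 1 \<le> i \<and> i \<le> n \<and> 1 \<le> j \<and> j \<le> 2} \<union>
     {(V i j, V (i + 1) (j + 1)) | i j. 1 \<le> i \<and> i + 1 \<le> n \<and> 1 \<le> j \<and> j \<le> 2}"

definition T3 :: "nat \<Rightarrow> vertex pair_pre_digraph" where
  "T3 n = \<lparr>pverts = {V i j | i j. 1 \<le> i \<and> i \<le> n \<and> 1 \<le> j \<and> j \<le> 3},
           parcs = T3_edges n \<union> (T3_edges n)\<inverse>\<rparr>"

definition graph_a :: "nat \<Rightarrow> vertex pair_pre_digraph" where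
  "graph_a n = add_to_graph (T3 n) {L1, R2, R3}
     {(L1, V 1 1), (L1, V 1 2),
      (V n 1, R2), (V n 2, R2), (V n 2, R3), (V n 3, R3), (R2, R3)}"

definition graph_b :: "nat \<Rightarrow> vertex pair_pre_digraph" where
  "graph_b n = add_to_graph (T3 n) {L1, R3}
     {(L1, V 1 1), (L1, V 1 2), (V n 2, R3), (V n 3, R3)}"

definition graph_c :: "nat \<Rightarrow> vertex pair_pre_digraph" where
  "graph_c n = add_to_graph (T3 n) {L1, L2, R2, R3}
     {(L1, V 1 1), (L1, V 1 2), (L2, V 1 2), (L2, V 1 3), (L1, L2),
      (V n 1, R2), (V n 2, R2), (V n 2, R3), (V n 3, R3), (R2, R3)}"

definition graph_d :: "nat \<Rightarrow> vertex pair_pre_digraph" where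
  "graph_d n = add_to_graph (T3 n) {R2, R3, R3'}
     {(V n 1, R2), (V n 2, R2), (V n 2, R3), (V n 3, R3), (R2, R3), (R2, R3'), (R3, R3')}"

definition graph_e :: "nat \<Rightarrow> vertex pair_pre_digraph" where
  "graph_e n = add_to_graph (T3 n) {R3} {(V n 2, R3), (V n 3, R3)}"

definition graph_f :: "nat \<Rightarrow> vertex pair_pre_digraph" where
  "graph_f n = add_to_graph (T3 n) {R2, R3}
     {(V n 1, R2), (V n 2, R2), (V n 2, R3), (V n 3, R3), (R2, R3)}"

lemma pair_graph_T3: "pair_graph (T3 n)"
proof
  have "{V i j | i j. 1 \<le> i \<and> i \<le> n \<and> 1 \<le> j \<and> j \<le> 3} = (\<lambda>(i, j). V i j) ` ({1..n} \<times> {1..3})"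
    by auto
  then show fin: "finite (pverts (T3 n))"
    by (simp add: T3_def)
  have sub: "parcs (T3 n) \<subseteq> pverts (T3 n) \<times> pverts (T3 n)"
    by (auto simp: T3_def T3_edges_def)
  then show "finite (parcs (T3 n))"
    using fin finite_subset by blast
  show "\<And>e. e \<in> parcs (T3 n) \<Longrightarrow> fst e \<in> pverts (T3 n)"
    and "\<And>e. e \<in> parcs (T3 n) \<Longrightarrow> snd e \<in> pverts (T3 n)"
    using sub by auto
  show "\<And>e. e \<in> parcs (T3 n) \<Longrightarrow> fst e \<noteq> snd e"
    by (auto simp: T3_def T3_edges_def)
  show "symmetric (with_proj (T3 n))"
    by (auto simp: symmetric_def T3_def intro!: symI)
qed

lemma pair_graph_add_to_graph:
  assumes "pair_graph G" "finite W" "E \<subseteq> (pverts G \<union> W) \<times> (pverts G \<union> W)" "irrefl E"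
  shows "pair_graph (add_to_graph G W E)"
proof -
  interpret pair_graph G by fact
  have symG: "(b, a) \<in> parcs G" if "(a, b) \<in> parcs G" for a b
    using that sym_arcs by (auto dest: symD simp: symmetric_def)
  have "finite E"
    using assms(2,3) by (meson finite_SigmaI finite_UnI finite_subset pair_finite_verts)
  then show ?thesis
    using assms symG
    by unfold_locales
      (auto simp: add_to_graph_def irrefl_def symmetric_def intro!: symI
        dest: in_arcsD1 in_arcsD2 no_loops')
qed

lemma pair_graph_graphs:
  assumes "n \<ge> 1"
  shows "pair_graph (graph_a n)" "pair_graph (graph_b n)" "pair_graph (graph_c n)"
    "pair_graph (graph_d n)" "pair_graph (graph_e n)" "pair_graph (graph_f n)"
  unfolding graph_a_def graph_b_def graph_c_def graph_d_def graph_e_def graph_f_def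
  using assms
  by (intro pair_graph_add_to_graph pair_graph_T3; auto simp: T3_def irrefl_def)+

end

theory Submission
  imports Defs
begin

text \<open>
  The first player opens at a vertex \<open>u\<close>, after which the opponent is confined to the set \<open>D\<close> of
  vertices outside the closed neighbourhood of \<open>u\<close>, and answers every move \<open>v\<close> by \<open>f v\<close>, where
  \<open>f\<close> preserves adjacency and moves no vertex of \<open>D\<close> into its own closed neighbourhood.  The replies
  may lie among the neighbours of \<open>u\<close>, which are out of reach for the opponent.  All the graphs
  are pieces of the triangular lattice, and \<open>u\<close> is taken in the middle row.  For \<open>T\<^bsub>n,3\<^esub>\<close>, (b) and (c) the map \<open>f\<close>
  is the half-turn and for (d) the reflection; its vertices moved by distance at most one lie
  around \<open>u\<close>.  The graphs (a), (e), (f) lack such a symmetry, but the closed neighbourhood of \<open>u\<close>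
  cuts them in two parts, each of which a translation carries into the union of the other part
  and the neighbourhood of \<open>u\<close>.
\<close>

section \<open>Pairing strategies on an arbitrary graph\<close>

lemma opponent_neq [simp]: "opponent p \<noteq> p" "p \<noteq> opponent p"
  by (cases p; simp)+

lemma opponent_opponent [simp]: "opponent (opponent p) = p"
  by (cases p) simp_all

text \<open>The reply \<open>f v\<close> is legal because an opponent's vertex \<open>x\<close> next
  to it would, by \<open>f_adj\<close>, make \<open>v\<close> adjacent to \<open>f x\<close>,
  already coloured in answer to \<open>x\<close>; the case \<open>x = v\<close> is excluded by
  \<open>f_nadj\<close>. \<open>f_inv\<close> is conditional because replies may leave
  \<open>D\<close>.\<close>

lemma pairing_first_player_win:
  fixes f :: "'v \<Rightarrow> 'v"
  assumes sym: "\<And>v w. (v, w) \<in> parcs G \<Longrightarrow> (w, v) \<in> parcs G"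
    and u: "u \<in> pverts G"
    and D: "\<And>v. v \<in> D \<longleftrightarrow> v \<in> pverts G \<and> v \<noteq> u \<and> (v, u) \<notin> parcs G"
    and f_mem: "\<And>v. v \<in> D \<Longrightarrow> f v \<in> pverts G"
    and f_u: "\<And>v. v \<in> D \<Longrightarrow> f v \<noteq> u"
    and f_self: "\<And>v. v \<in> D \<Longrightarrow> f v \<noteq> v"
    and f_nadj: "\<And>v. v \<in> D \<Longrightarrow> (f v, v) \<notin> parcs G"
    and f_inj: "inj_on f D"
    and f_inv: "\<And>v. v \<in> D \<Longrightarrow> f v \<in> D \<Longrightarrow> f (f v) = v"
    and f_adj: "\<And>v x. v \<in> D \<Longrightarrow> x \<in> D \<Longrightarrow> (f v, x) \<in> parcs G \<Longrightarrow> (v, f x) \<in> parcs G"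
  shows "snort_first_player_win G"
  unfolding snort_first_player_win_def
proof
  fix p
  define q where "q = opponent p"
  have [simp]: "q \<noteq> p" "p \<noteq> q"
    by (simp_all add: q_def)
  \<comment> \<open>A strategy sees only the colouring, so the opponent's last move is recovered as
    their one vertex whose reply is still uncoloured.\<close>
  define s where "s c = (if c u = None then u
      else f (SOME v. c v = Some q \<and> c (f v) = None))" for c
  \<comment> \<open>The invariant at the turns of \<open>p\<close> after the opening:
    \<open>v0\<close> is the opponent's pending move, and every other vertex of theirs has been
    answered.\<close>
  define paired where "paired c v0 \<longleftrightarrow> c u = Some p \<and> c v0 = Some q
      \<and> (\<forall>v. c v = Some q \<longrightarrow> v \<in> D \<and> (v \<noteq> v0 \<longrightarrow> c (f v) = Some p))
      \<and> (\<forall>v. c v = Some p \<longrightarrow> v = u \<or> (\<exists>r. r \<noteq> v0 \<and> c r = Some q \<and> v = f r))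
      \<and> (\<forall>v w. (v, w) \<in> parcs G \<longrightarrow> c v = Some q \<longrightarrow> c w \<noteq> Some p)" for c v0
  have reply: "s c = f v0 \<and> c (f v0) = None \<and> legal G p c (f v0)" if "paired c v0" for c v0
  proof -
    have cu: "c u = Some p" and v0: "c v0 = Some q"
      and red: "\<And>v. c v = Some q \<Longrightarrow> v \<in> D"
      and red_f: "\<And>v. c v = Some q \<Longrightarrow> v \<noteq> v0 \<Longrightarrow> c (f v) = Some p"
      and blue: "\<And>v. c v = Some p \<Longrightarrow> v = u \<or> (\<exists>r. r \<noteq> v0 \<and> c r = Some q \<and> v = f r)"
      and proper: "\<And>v w. (v, w) \<in> parcs G \<Longrightarrow> c v = Some q \<Longrightarrow> c w \<noteq> Some p"
      using that unfolding paired_def by blast+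
    have v0D: "v0 \<in> D"
      using v0 red by blast
    have "c (f v0) \<noteq> Some p"
    proof
      assume "c (f v0) = Some p"
      then obtain r where "r \<noteq> v0" "c r = Some q" "f v0 = f r"
        using blue f_u[OF v0D] by blast
      then show False
        using f_inj red v0D by (metis inj_on_def)
    qed
    \<comment> \<open>If the opponent held \<open>f v0\<close>, that vertex would have been answered
      by \<open>f (f v0) = v0\<close>, giving \<open>v0\<close> the colour of
      \<open>p\<close>.\<close>
    moreover have "c (f v0) \<noteq> Some q"
    proof
      assume *: "c (f v0) = Some q"
      then have "c (f (f v0)) = Some p"
        using red_f f_self[OF v0D] by blast
      then show False
        using f_inv[OF v0D] red[OF *] v0 by simp
    qed
    ultimately have none: "c (f v0) = None"
      by (metis q_def not_None_eq opponent.simps player.exhaust)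
    have "(SOME v. c v = Some q \<and> c (f v) = None) = v0"
      using v0 none red_f by (intro some_equality) force+
    moreover have "c w \<noteq> Some q" if "(f v0, w) \<in> parcs G" for w
    proof
      assume w: "c w = Some q"
      then have "w \<noteq> v0"
        using that f_nadj[OF v0D] by blast
      moreover have "(v0, f w) \<in> parcs G"
        using f_adj[OF v0D red[OF w] that] .
      ultimately show False
        using proper v0 red_f[OF w] by blast
    qed
    ultimately show ?thesis
      using none cu f_mem[OF v0D] by (simp add: s_def legal_def q_def)
  qed
  have inv: "c = (\<lambda>_. None) \<or> (\<exists>v0. paired c v0)" if "c \<in> turns G p s" for c
    using that
  proof induction
    case start
    then show ?case by simp
  next
    case (round c w)
    let ?c = "(c(s c := Some p))(w := Some q)"
    have w: "w \<in> pverts G" "(c(s c := Some p)) w = None"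
      and w_adj: "\<And>x. (w, x) \<in> parcs G \<Longrightarrow> (c(s c := Some p)) x \<noteq> Some p"
      using round(3) by (auto simp: legal_def move_def q_def)
    \<comment> \<open>The new move \<open>w\<close> becomes the pending one; unless the opening has
      just been played, there was an earlier pending \<open>v0\<close>, which is now
      answered.\<close>
    have "paired ?c w"
    proof (cases "c = (\<lambda>_. None)")
      case True
      then have "s c = u"
        by (simp add: s_def)
      then have "w \<in> D" "w \<noteq> u"
        using w w_adj[of u] D by (auto split: if_splits)
      then show ?thesis
        using True \<open>s c = u\<close> w_adj by (auto simp: paired_def)
    next
      case False
      then obtain v0 where v0: "paired c v0"
        using round by blast
      have r: "s c = f v0" "c (f v0) = None" "legal G p c (f v0)"
        using reply[OF v0] by blast+
      have cu: "c u = Some p"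
        using v0 by (simp add: paired_def)
      have wu: "w \<noteq> u" "w \<noteq> f v0" "c w = None"
        using w r(1) cu by (auto split: if_splits)
      \<comment> \<open>\<open>u\<close> carries the colour of \<open>p\<close>, so its neighbours
        are closed to the opponent.\<close>
      have "w \<in> D"
        using D w(1) wu(1) w_adj[of u] cu r(1) f_u by (metis fun_upd_apply)
      have nq: "c x \<noteq> Some q" if "(f v0, x) \<in> parcs G \<or> (x, f v0) \<in> parcs G" for x
        using r(3) that sym by (auto simp: legal_def q_def)
      have wp: "c x \<noteq> Some p \<and> x \<noteq> f v0" if "(w, x) \<in> parcs G" for x
        using w_adj[OF that] r(1) by (auto split: if_splits)
      have v0q: "c v0 = Some q"
        and red: "\<And>v. c v = Some q \<Longrightarrow> v \<in> D"
        and red_f: "\<And>v. c v = Some q \<Longrightarrow> v \<noteq> v0 \<Longrightarrow> c (f v) = Some p"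
        and blue: "\<And>v. c v = Some p \<Longrightarrow> v = u \<or> (\<exists>r. r \<noteq> v0 \<and> c r = Some q \<and> v = f r)"
        and proper: "\<And>v w. (v, w) \<in> parcs G \<Longrightarrow> c v = Some q \<Longrightarrow> c w \<noteq> Some p"
        using v0 unfolding paired_def by blast+
      have "?c u = Some p" "?c w = Some q"
        using cu wu r by auto
      moreover have "v \<in> D \<and> (v \<noteq> w \<longrightarrow> ?c (f v) = Some p)" if "?c v = Some q" for v
      proof (cases "v = w")
        case False
        then have cv: "c v = Some q"
          using that r(1) by (auto split: if_splits)
        show ?thesis
          using cv red red_f[OF cv] r(1) wu by (cases "v = v0") auto
      qed (use \<open>w \<in> D\<close> in simp)
      moreover have "v = u \<or> (\<exists>r. r \<noteq> w \<and> ?c r = Some q \<and> v = f r)" if "?c v = Some p" for v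
      proof (cases "v = f v0")
        case True
        moreover have "v0 \<noteq> w" "v0 \<noteq> f v0"
          using v0q wu(3) r(2) by auto
        ultimately show ?thesis
          using v0q r(1) by auto
      next
        case False
        then have "c v = Some p"
          using that r(1) by (auto split: if_splits)
        then consider "v = u" | x where "c x = Some q" "v = f x"
          using blue by blast
        then show ?thesis
        proof cases
          case 2
          then have "x \<noteq> w" "x \<noteq> f v0"
            using wu(3) r(2) by auto
          then show ?thesis
            using 2 r(1) by auto
        qed simp
      qed
      moreover have "?c y \<noteq> Some p" if vy: "(v, y) \<in> parcs G" "?c v = Some q" for v y
      proof -
        consider "v = w" | "c v = Some q" "v \<noteq> w" "v \<noteq> f v0"
          using vy(2) r(1) by (auto split: if_splits)
        then show ?thesis
          using wp[of y] vy(1) nq[of v] proper[of v y] r(1) by cases auto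
      qed
      ultimately show ?thesis
        unfolding paired_def by blast
    qed
    then show ?case
      by (metis move_def q_def)
  qed
  have "legal G p c (s c)" if "c \<in> turns G p s" for c
    using inv[OF that]
  proof
    assume "c = (\<lambda>_. None)"
    then show ?thesis
      using u by (simp add: s_def legal_def)
  next
    assume "\<exists>v0. paired c v0"
    then show ?thesis
      using reply by force
  qed
  then show "\<exists>s. winning_strategy G p s"
    unfolding winning_strategy_def by blast
qed

section \<open>Finite pieces of the triangular lattice\<close>

text \<open>The triangular lattice in oblique coordinates, column first and row second. Over the
  integers, half-turns and translations involve no truncated subtraction.\<close>

definition tri_adj :: "int \<times> int \<Rightarrow> int \<times> int \<Rightarrow> bool" where
  "tri_adj v w \<longleftrightarrow>
    fst w = fst v + 1 \<and> snd w = snd v \<or> fst v = fst w + 1 \<and> snd v = snd w \<or>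
    fst w = fst v \<and> snd w = snd v + 1 \<or> fst v = fst w \<and> snd v = snd w + 1 \<or>
    fst w = fst v + 1 \<and> snd w = snd v + 1 \<or> fst v = fst w + 1 \<and> snd v = snd w + 1"

text \<open>Each row has its own end columns, since the vertices added to \<open>T3 n\<close> merely
  lengthen rows at their ends.\<close>

definition strip :: "(int \<Rightarrow> int) \<Rightarrow> (int \<Rightarrow> int) \<Rightarrow> (int \<times> int) set" where
  "strip l h = {(i, j). j \<in> {1, 2, 3} \<and> l j \<le> i \<and> i \<le> h j}"

text \<open>An isomorphism onto the induced subgraph of the lattice.\<close>

definition tri_embedding ::
    "('v \<Rightarrow> int \<times> int) \<Rightarrow> 'v pair_pre_digraph \<Rightarrow> (int \<times> int) set \<Rightarrow> bool" where
  "tri_embedding pos G S \<longleftrightarrow> bij_betw pos (pverts G) S \<and>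
     (\<forall>v w. (v, w) \<in> parcs G \<longleftrightarrow> v \<in> pverts G \<and> w \<in> pverts G \<and> tri_adj (pos v) (pos w))"

lemma tri_adj_sym: "tri_adj v w \<Longrightarrow> tri_adj w v"
  by (auto simp: tri_adj_def)

text \<open>Transports the pairing lemma to coordinates, where its conditions become integer
  arithmetic.\<close>

lemma tri_pairing_first_player_win:
  assumes emb: "tri_embedding pos G S"
    and u: "u \<in> S"
    and D: "D = {v \<in> S. v \<noteq> u \<and> \<not> tri_adj v u}"
    and g_mem: "\<And>v. v \<in> D \<Longrightarrow> g v \<in> S - {u}"
    and g_nadj: "\<And>v. v \<in> D \<Longrightarrow> g v \<noteq> v \<and> \<not> tri_adj (g v) v"
    and g_inj: "inj_on g D"
    and g_inv: "\<And>v. v \<in> D \<Longrightarrow> g v \<in> D \<Longrightarrow> g (g v) = v"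
    and g_adj: "\<And>v x. v \<in> D \<Longrightarrow> x \<in> D \<Longrightarrow> tri_adj (g v) x \<Longrightarrow> tri_adj v (g x)"
  shows "snort_first_player_win G"
proof -
  define vtx where "vtx = inv_into (pverts G) pos"
  have bij: "bij_betw pos (pverts G) S"
    and parcs: "\<And>v w. (v, w) \<in> parcs G \<longleftrightarrow> v \<in> pverts G \<and> w \<in> pverts G \<and> tri_adj (pos v) (pos w)"
    using emb by (auto simp: tri_embedding_def)
  have vtx_pos [simp]: "vtx (pos v) = v" if "v \<in> pverts G" for v
    using bij that by (simp add: vtx_def bij_betw_inv_into_left)
  have pos_vtx [simp]: "pos (vtx x) = x" if "x \<in> S" for x
    using bij that by (simp add: vtx_def bij_betw_inv_into_right)
  have vtx_mem [simp]: "vtx x \<in> pverts G" if "x \<in> S" for x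
    using bij that by (metis vtx_def bij_betw_def inv_into_into)
  have pos_mem [simp]: "pos v \<in> S" if "v \<in> pverts G" for v
    using bij that by (auto simp: bij_betw_def)
  have pos_D: "v \<in> pverts G \<and> pos v \<in> D \<longleftrightarrow> v \<in> pverts G \<and> v \<noteq> vtx u \<and> (v, vtx u) \<notin> parcs G" for v
    using u by (auto simp: D parcs)
  have gS: "g v \<in> S" if "v \<in> D" for v
    using g_mem[OF that] by auto
  define f where "f v = vtx (g (pos v))" for v
  define D' where "D' = {v \<in> pverts G. pos v \<in> D}"
  have pos_f: "pos (f v) = g (pos v)" and f_mem: "f v \<in> pverts G" if "v \<in> D'" for v
    using that gS by (simp_all add: f_def D'_def)
  have D'D: "v \<in> pverts G" "pos v \<in> D" if "v \<in> D'" for v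
    using that by (simp_all add: D'_def)
  show ?thesis
  proof (rule pairing_first_player_win[where u = "vtx u" and f = f and D = D'])
    show "(w, v) \<in> parcs G" if "(v, w) \<in> parcs G" for v w
      using that tri_adj_sym by (auto simp: parcs)
    show "vtx u \<in> pverts G"
      using u by simp
    show "v \<in> D' \<longleftrightarrow> v \<in> pverts G \<and> v \<noteq> vtx u \<and> (v, vtx u) \<notin> parcs G" for v
      using pos_D[of v] by (simp add: D'_def)
    show "f v \<in> pverts G" if "v \<in> D'" for v
      using f_mem[OF that] .
    show "f v \<noteq> vtx u" if "v \<in> D'" for v
      using g_mem[OF D'D(2)[OF that]] pos_f[OF that] pos_vtx[OF u] by auto
    show "f v \<noteq> v" if "v \<in> D'" for v
      using g_nadj[OF D'D(2)[OF that]] pos_f[OF that] by auto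
    show "(f v, v) \<notin> parcs G" if "v \<in> D'" for v
      using g_nadj[OF D'D(2)[OF that]] pos_f[OF that] by (simp add: parcs)
    show "inj_on f D'"
    proof (rule inj_onI)
      fix v w
      assume vw: "v \<in> D'" "w \<in> D'" "f v = f w"
      then have "g (pos v) = g (pos w)"
        by (metis pos_f)
      then have "pos v = pos w"
        using g_inj vw D'D by (meson inj_onD)
      then show "v = w"
        using vw D'D by (metis vtx_pos)
    qed
    show "f (f v) = v" if "v \<in> D'" "f v \<in> D'" for v
    proof -
      have "g (pos v) \<in> D"
        using D'D(2)[OF that(2)] pos_f[OF that(1)] by simp
      then show ?thesis
        using g_inv[of "pos v"] D'D[OF that(1)] pos_f[OF that(1)] by (simp add: f_def)
    qed
    show "(v, f x) \<in> parcs G" if "v \<in> D'" "x \<in> D'" "(f v, x) \<in> parcs G" for v x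
      using that(3) g_adj[OF D'D(2)[OF that(1)] D'D(2)[OF that(2)]] that(1,2) D'D(1) f_mem
      by (simp add: parcs pos_f)
  qed
qed

section \<open>Pairings of a strip by half-turn, reflection and translation\<close>

text \<open>The half-turn displaces \<open>(i, j)\<close> by \<open>(s - 2 * i, 4 - 2 * j)\<close>,
  which is at most one step only in row 2 at the centre. For even \<open>s\<close> this concerns the
  fixed vertex \<open>(k, 2)\<close> alone, for odd \<open>s\<close> the exchanged neighbours
  \<open>(k, 2)\<close> and \<open>(k + 1, 2)\<close>; none of them lies in
  \<open>D\<close>.\<close>

lemma rotation_first_player_win:
  assumes "tri_embedding pos G (strip l h)"
    and "\<And>j. j \<in> {1, 2, 3} \<Longrightarrow> l j + h (4 - j) = s"
    and "l 2 \<le> h 2"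
  shows "snort_first_player_win G"
proof -
  have lh: "l 1 = s - h 3" "l 2 = s - h 2" "l 3 = s - h 1"
    using assms(2)[of 1] assms(2)[of 2] assms(2)[of 3] by auto
  define k where "k = s div 2"
  have k: "s = 2 * k \<or> s = 2 * k + 1"
    unfolding k_def by presburger
  define D where "D = {v \<in> strip l h. v \<noteq> (k, 2) \<and> \<not> tri_adj v (k, 2)}"
  let ?g = "\<lambda>(i, j). (s - i, 4 - j) :: int \<times> int"
  show ?thesis
  proof (rule tri_pairing_first_player_win[OF assms(1), where g = ?g and D = D])
    show "(k, 2) \<in> strip l h"
      using lh k assms(3) by (auto simp: strip_def)
    fix v
    assume "v \<in> D"
    then obtain i j where v: "v = (i, j)" "j \<in> {1, 2, 3}" "l j \<le> i" "i \<le> h j"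
        "(i, j) \<noteq> (k, 2)" "\<not> tri_adj (i, j) (k, 2)"
      by (auto simp: D_def strip_def)
    then show "?g v \<in> strip l h - {(k, 2)}"
      using lh k by (elim insertE) (auto simp: strip_def tri_adj_def)
    show "?g v \<noteq> v \<and> \<not> tri_adj (?g v) v"
      using v(2,5,6) k unfolding v(1) tri_adj_def by simp presburger
  next
    show "tri_adj v (?g x)" if "tri_adj (?g v) x" for v x
      using that unfolding tri_adj_def case_prod_beta fst_conv snd_conv by presburger
  qed (auto simp: D_def inj_on_def)
qed

text \<open>The reflection reverses each row, and row \<open>j\<close> is centred at column
  \<open>(s + j) / 2\<close>. The vertices moved by at most one step thus occur in all rows, but the
  centres drift by half a column per row, which keeps these vertices within the closed neighbourhood
  of \<open>(k, 2)\<close>.\<close>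

lemma reflection_first_player_win:
  assumes "tri_embedding pos G (strip l h)"
    and "\<And>j. j \<in> {1, 2, 3} \<Longrightarrow> l j + h j = s + j"
    and "l 2 \<le> h 2"
  shows "snort_first_player_win G"
proof -
  have lh: "l 1 = s + 1 - h 1" "l 2 = s + 2 - h 2" "l 3 = s + 3 - h 3"
    using assms(2)[of 1] assms(2)[of 2] assms(2)[of 3] by auto
  define k where "k = (s + 2) div 2"
  have k: "s + 2 = 2 * k \<or> s + 2 = 2 * k + 1"
    unfolding k_def by presburger
  define D where "D = {v \<in> strip l h. v \<noteq> (k, 2) \<and> \<not> tri_adj v (k, 2)}"
  let ?g = "\<lambda>(i, j). (s + j - i, j) :: int \<times> int"
  show ?thesis
  proof (rule tri_pairing_first_player_win[OF assms(1), where g = ?g and D = D])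
    show "(k, 2) \<in> strip l h"
      using lh k assms(3) by (auto simp: strip_def)
    fix v
    assume "v \<in> D"
    then obtain i j where v: "v = (i, j)" "j \<in> {1, 2, 3}" "l j \<le> i" "i \<le> h j"
        "(i, j) \<noteq> (k, 2)" "\<not> tri_adj (i, j) (k, 2)"
      by (auto simp: D_def strip_def)
    then show "?g v \<in> strip l h - {(k, 2)}"
      using lh k by (elim insertE) (auto simp: strip_def tri_adj_def)
    show "?g v \<noteq> v \<and> \<not> tri_adj (?g v) v"
      using v(2,5,6) k unfolding v(1) tri_adj_def by simp presburger
  next
    show "tri_adj v (?g x)" if "tri_adj (?g v) x" for v x
      using that unfolding tri_adj_def case_prod_beta fst_conv snd_conv by presburger
  qed (auto simp: D_def inj_on_def)
qed

text \<open>
  The left part of the strip moves by \<open>t\<close> and the right part by \<open>-t\<close>; the first two lines of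
  inequalities say that the image of a part does not touch that part, the last two that it
  stays inside the strip.
\<close>

lemma translation_first_player_win:
  fixes k t :: int
  assumes "tri_embedding pos G (strip l h)"
    and u: "l 2 \<le> k" "k \<le> h 2"
    and "l 1 + t \<ge> k" "l 2 + t \<ge> k + 1" "l 3 + t \<ge> k + 1"
    and "h 1 - t \<le> k - 1" "h 2 - t \<le> k - 1" "h 3 - t \<le> k"
    and "k - 2 + t \<le> h 1" "k - 2 + t \<le> h 2" "k - 1 + t \<le> h 3"
    and "k + 1 - t \<ge> l 1" "k + 2 - t \<ge> l 2" "k + 2 - t \<ge> l 3"
    and t: "t \<ge> 2"
  shows "snort_first_player_win G"
proof -
  note bounds = assms(4-15)
  define D where "D = {v \<in> strip l h. v \<noteq> (k, 2) \<and> \<not> tri_adj v (k, 2)}"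
  \<comment> \<open>The neighbours of \<open>(k, 2)\<close> are in columns \<open>k - 1\<close> and
    \<open>k\<close> of row 1, \<open>k - 1\<close> and \<open>k + 1\<close> of row 2,
    \<open>k\<close> and \<open>k + 1\<close> of row 3; hence the staggered ends of the left part
    \<open>A\<close> and the right part \<open>B\<close>.\<close>
  define A where "A i j \<longleftrightarrow> j = 1 \<and> l 1 \<le> i \<and> i \<le> k - 2
    \<or> j = 2 \<and> l 2 \<le> i \<and> i \<le> k - 2 \<or> j = 3 \<and> l 3 \<le> i \<and> i \<le> k - 1" for i j :: int
  define B where "B i j \<longleftrightarrow> j = 1 \<and> k + 1 \<le> i \<and> i \<le> h 1
    \<or> j = 2 \<and> k + 2 \<le> i \<and> i \<le> h 2 \<or> j = 3 \<and> k + 2 \<le> i \<and> i \<le> h 3" for i j :: int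
  have D_AB: "A (fst v) (snd v) \<or> B (fst v) (snd v)" if "v \<in> D" for v
  proof -
    obtain i j where v: "v = (i, j)" and j: "j \<in> {1, 2, 3}" and i: "l j \<le> i" "i \<le> h j"
      and ij: "i \<noteq> k \<or> j \<noteq> 2" "\<not> tri_adj (i, j) (k, 2)"
      using \<open>v \<in> D\<close> by (auto simp: D_def strip_def)
    consider "j = 1" | "j = 2" | "j = 3"
      using j by auto
    then have "A i j \<or> B i j"
      using i ij unfolding tri_adj_def A_def B_def fst_conv snd_conv by cases (simp; presburger)+
    then show ?thesis
      by (simp add: v)
  qed
  have AB: "\<not> (A i j \<and> B i j)" for i j
    by (auto simp: A_def B_def)
  have A_strip: "(i + t, j) \<in> strip l h" and A_not_A: "\<not> A (i + t) j"
    and A_u: "(i + t, j) \<noteq> (k, 2)" if "A i j" for i j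
    using that bounds t by (auto simp: A_def strip_def)
  have B_strip: "(i - t, j) \<in> strip l h" and B_not_B: "\<not> B (i - t) j"
    and B_u: "(i - t, j) \<noteq> (k, 2)" if "B i j" for i j
    using that bounds t by (auto simp: B_def strip_def)
  have A_nadj: "\<not> tri_adj (i + t, j) (i', j')" if "A i j" "A i' j'" for i j i' j'
    using that bounds(1-3) unfolding A_def tri_adj_def fst_conv snd_conv by presburger
  have B_nadj: "\<not> tri_adj (i - t, j) (i', j')" if "B i j" "B i' j'" for i j i' j'
    using that bounds(4-6) unfolding B_def tri_adj_def fst_conv snd_conv by presburger
  \<comment> \<open>In every row the image of \<open>A\<close> lies to the right of the image of
    \<open>B\<close>; this makes \<open>g\<close> injective across the two parts.\<close>
  have AB_image: "i + t \<noteq> i' - t \<or> j \<noteq> j'" if "A i j" "B i' j'" for i j i' j'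
    using that bounds(1-6) unfolding A_def B_def by presburger
  define g where "g v = (if A (fst v) (snd v) then (fst v + t, snd v) else (fst v - t, snd v))" for v
  have gA: "g v = (fst v + t, snd v)" if "A (fst v) (snd v)" for v
    using that by (simp add: g_def)
  have gB: "g v = (fst v - t, snd v)" if "B (fst v) (snd v)" for v
    using that AB by (auto simp: g_def)
  show ?thesis
  proof (rule tri_pairing_first_player_win[OF assms(1), where g = g and D = D])
    show "(k, 2) \<in> strip l h"
      using u by (auto simp: strip_def)
    fix v
    assume v: "v \<in> D"
    show "g v \<in> strip l h - {(k, 2)}"
      using D_AB[OF v] by (auto simp: gA gB A_strip B_strip dest: A_u B_u)
    show "g v \<noteq> v \<and> \<not> tri_adj (g v) v"
      using D_AB[OF v] gA[of v] gB[of v] t A_nadj[of "fst v" "snd v" "fst v" "snd v"]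
        B_nadj[of "fst v" "snd v" "fst v" "snd v"] by (cases v) auto
    show "g (g v) = v" if "g v \<in> D"
      using D_AB[OF v] D_AB[OF that] gA[of v] gB[of v] gA[of "g v"] gB[of "g v"] A_not_A B_not_B
      by (auto simp: prod_eq_iff)
    show "tri_adj v (g x)" if x: "x \<in> D" "tri_adj (g v) x" for x
    proof -
      \<comment> \<open>No image touches its own part, so adjacency of \<open>g v\<close> and
        \<open>x\<close> puts \<open>v\<close> and \<open>x\<close> in different parts. They move by
        opposite vectors, which carries the edge between \<open>g v\<close> and \<open>x\<close> to
        one between \<open>v\<close> and \<open>g x\<close>.\<close>
      have "\<not> (A (fst v) (snd v) \<and> A (fst x) (snd x))" "\<not> (B (fst v) (snd v) \<and> B (fst x) (snd x))"
        using x(2) gA[of v] gB[of v] A_nadj[of "fst v" "snd v" "fst x" "snd x"]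
          B_nadj[of "fst v" "snd v" "fst x" "snd x"] by auto
      then consider "g v = (fst v + t, snd v)" "g x = (fst x - t, snd x)"
        | "g v = (fst v - t, snd v)" "g x = (fst x + t, snd x)"
        using D_AB[OF v] D_AB[OF x(1)] gA gB by blast
      then show ?thesis
      proof cases
        case 1
        show ?thesis
          using x(2) unfolding 1 tri_adj_def fst_conv snd_conv by presburger
      next
        case 2
        show ?thesis
          using x(2) unfolding 2 tri_adj_def fst_conv snd_conv by presburger
      qed
    qed
  next
    show "inj_on g D"
    proof (rule inj_onI)
      fix v w
      assume "v \<in> D" "w \<in> D" and eq: "g v = g w"
      then show "v = w"
        using D_AB[of v] D_AB[of w] AB_image[of "fst v" "snd v" "fst w" "snd w"]
          AB_image[of "fst w" "snd w" "fst v" "snd v"]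
        by (auto simp: gA gB prod_eq_iff)
    qed
  qed (simp add: D_def)
qed

section \<open>Coordinates for the seven graphs\<close>

text \<open>The additional vertices take the places that their names suggest in columns 0, \<open>n + 1\<close> and \<open>n + 2\<close>.\<close>

fun pos :: "nat \<Rightarrow> vertex \<Rightarrow> int \<times> int" where
  "pos n (V i j) = (int i, int j)"
| "pos n L1 = (0, 1)"
| "pos n L2 = (0, 2)"
| "pos n R2 = (int n + 1, 2)"
| "pos n R3 = (int n + 1, 3)"
| "pos n R3' = (int n + 2, 3)"

lemma pverts_T3_simps [simp]:
  "V i j \<in> pverts (T3 n) \<longleftrightarrow> 1 \<le> i \<and> i \<le> n \<and> 1 \<le> j \<and> j \<le> 3"
  "L1 \<notin> pverts (T3 n)" "L2 \<notin> pverts (T3 n)"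
  "R2 \<notin> pverts (T3 n)" "R3 \<notin> pverts (T3 n)" "R3' \<notin> pverts (T3 n)"
  by (simp_all add: T3_def)

lemma tri_embedding_T3: "tri_embedding (pos n) (T3 n) (strip (\<lambda>_. 1) (\<lambda>_. int n))"
  unfolding tri_embedding_def bij_betw_def
proof (intro conjI allI)
  show "inj_on (pos n) (pverts (T3 n))"
    by (auto simp: T3_def inj_on_def)
  have "(i, j) \<in> pos n ` pverts (T3 n)" if "(i, j) \<in> strip (\<lambda>_. 1) (\<lambda>_. int n)" for i j
  proof (rule image_eqI)
    show "(i, j) = pos n (V (nat i) (nat j))"
      using that by (auto simp: strip_def)
    show "V (nat i) (nat j) \<in> pverts (T3 n)"
      using that by (auto simp: strip_def T3_def)
  qed
  moreover have "pos n v \<in> strip (\<lambda>_. 1) (\<lambda>_. int n)" if "v \<in> pverts (T3 n)" for v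
    using that by (auto simp: strip_def T3_def)
  ultimately show "pos n ` pverts (T3 n) = strip (\<lambda>_. 1) (\<lambda>_. int n)"
    by auto
  have "(V i j, V i' j') \<in> parcs (T3 n) \<longleftrightarrow>
      V i j \<in> pverts (T3 n) \<and> V i' j' \<in> pverts (T3 n) \<and> tri_adj (pos n (V i j)) (pos n (V i' j'))"
    for i j i' j'
  proof -
    have edge: "(V a b, V a' b') \<in> T3_edges n \<longleftrightarrow> 1 \<le> a \<and> a' \<le> n \<and> 1 \<le> b \<and> b' \<le> 3 \<and>
        (a' = a + 1 \<and> b' = b \<or> a' = a \<and> b' = b + 1 \<or> a' = a + 1 \<and> b' = b + 1)" for a b a' b'
      by (auto simp: T3_edges_def)
    have succ: "int a = int b + 1 \<longleftrightarrow> a = b + 1" for a b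
      by linarith
    show ?thesis
      by (auto simp: T3_def edge tri_adj_def succ)
  qed
  moreover have "\<exists>i j. v = V i j" if "v \<in> pverts (T3 n)" for v
    using that by (auto simp: T3_def)
  moreover have "v \<in> pverts (T3 n) \<and> w \<in> pverts (T3 n)" if "(v, w) \<in> parcs (T3 n)" for v w
    using that by (auto simp: T3_def T3_edges_def)
  ultimately show "(v, w) \<in> parcs (T3 n) \<longleftrightarrow>
      v \<in> pverts (T3 n) \<and> w \<in> pverts (T3 n) \<and> tri_adj (pos n v) (pos n w)" for v w
    by metis
qed

text \<open>Old pairs are settled by \<open>emb\<close>, so it suffices to compare \<open>E\<close>
  with the lattice edges meeting \<open>W\<close>. \<open>E_all\<close> accepts either orientation
  because \<open>E\<close> lists each edge in only one.\<close>

lemma tri_embedding_add_to_graph: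
  assumes emb: "tri_embedding f G S"
    and S': "S' = S \<union> f ` W" and disj: "S \<inter> f ` W = {}" and inj: "inj_on f W"
    and E: "\<And>v w. (v, w) \<in> E \<Longrightarrow>
      v \<in> pverts G \<union> W \<and> w \<in> pverts G \<union> W \<and> (v \<in> W \<or> w \<in> W) \<and> tri_adj (f v) (f w)"
    and E_all: "\<And>v w. v \<in> pverts G \<union> W \<Longrightarrow> w \<in> W \<Longrightarrow> tri_adj (f v) (f w) \<Longrightarrow> (v, w) \<in> E \<union> E\<inverse>"
  shows "tri_embedding f (add_to_graph G W E) S'"
  unfolding tri_embedding_def
proof (intro conjI allI)
  have bij: "bij_betw f (pverts G) S"
    and parcs: "\<And>v w. (v, w) \<in> parcs G \<longleftrightarrow> v \<in> pverts G \<and> w \<in> pverts G \<and> tri_adj (f v) (f w)"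
    using emb by (auto simp: tri_embedding_def)
  show "bij_betw f (pverts (add_to_graph G W E)) S'"
    using bij_betw_combine[OF bij inj_on_imp_bij_betw[OF inj] disj] S'
    by (simp add: add_to_graph_def)
  show "(v, w) \<in> parcs (add_to_graph G W E) \<longleftrightarrow> v \<in> pverts (add_to_graph G W E)
      \<and> w \<in> pverts (add_to_graph G W E) \<and> tri_adj (f v) (f w)" for v w
  proof -
    have comm: "tri_adj (f w) (f v) \<longleftrightarrow> tri_adj (f v) (f w)"
      using tri_adj_sym by blast
    show ?thesis
      using E[of v w] E[of w v] E_all[of v w] E_all[of w v] parcs[of v w]
      unfolding comm by (auto simp: add_to_graph_def)
  qed
qed

text \<open>Separates the edges from \<open>W\<close> to the grid from those inside
  \<open>W\<close>, so that for concrete \<open>W\<close> and \<open>E\<close> only finite case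
  distinctions with linear arithmetic remain.\<close>

lemma tri_embedding_extend_T3:
  assumes W: "W \<subseteq> {L1, L2, R2, R3, R3'}"
    and S: "S = strip (\<lambda>_. 1) (\<lambda>_. int n) \<union> pos n ` W"
    and E: "\<And>v w. (v, w) \<in> E \<Longrightarrow> v \<in> pverts (T3 n) \<union> W \<and> w \<in> pverts (T3 n) \<union> W
      \<and> (v \<in> W \<or> w \<in> W) \<and> tri_adj (pos n v) (pos n w)"
    and E_T3: "\<And>i j w. 1 \<le> i \<Longrightarrow> i \<le> n \<Longrightarrow> w \<in> W \<Longrightarrow> tri_adj (int i, int j) (pos n w)
      \<Longrightarrow> 1 \<le> j \<Longrightarrow> j \<le> 3 \<Longrightarrow> (V i j, w) \<in> E \<union> E\<inverse>"
    and E_W: "\<And>v w. v \<in> W \<Longrightarrow> w \<in> W \<Longrightarrow> tri_adj (pos n v) (pos n w) \<Longrightarrow> (v, w) \<in> E \<union> E\<inverse>"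
  shows "tri_embedding (pos n) (add_to_graph (T3 n) W E) S"
proof (rule tri_embedding_add_to_graph[OF tri_embedding_T3 S _ _ E])
  show "strip (\<lambda>_. 1) (\<lambda>_. int n) \<inter> pos n ` W = {}"
    using W by (auto simp: strip_def)
  show "inj_on (pos n) W"
    by (rule inj_on_subset[OF _ W]) (auto simp: inj_on_def)
  show "(v, w) \<in> E \<union> E\<inverse>"
    if vw: "v \<in> pverts (T3 n) \<union> W" "w \<in> W" "tri_adj (pos n v) (pos n w)" for v w
  proof (cases "v \<in> W")
    case True
    then show ?thesis
      using E_W vw by blast
  next
    case False
    then obtain i j where "v = V i j" "1 \<le> i" "i \<le> n" "1 \<le> j" "j \<le> 3"
      using vw by (auto simp: T3_def)
    then show ?thesis
      using E_T3[of i w j] vw by simp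
  qed
qed

section \<open>Openings and pairings for the individual graphs\<close>

theorem theorem3p8:
  fixes n :: nat
  assumes "n \<ge> 1"
  shows "snort_first_player_win (T3 n)
    \<and> snort_first_player_win (graph_a n)
    \<and> snort_first_player_win (graph_b n)
    \<and> snort_first_player_win (graph_c n)
    \<and> snort_first_player_win (graph_d n)
    \<and> snort_first_player_win (graph_e n)
    \<and> (even n \<longrightarrow> snort_first_player_win (graph_f n))"
proof (intro conjI impI)
  have a: "tri_embedding (pos n) (graph_a n)
      (strip (\<lambda>j. if j = 1 then 0 else 1) (\<lambda>j. if j = 1 then int n else int n + 1))"
    unfolding graph_a_def
    by (rule tri_embedding_extend_T3; (elim insertE emptyE)?;
        use assms in \<open>auto simp: strip_def tri_adj_def\<close>)
  have b: "tri_embedding (pos n) (graph_b n)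
      (strip (\<lambda>j. if j = 1 then 0 else 1) (\<lambda>j. if j = 3 then int n + 1 else int n))"
    unfolding graph_b_def
    by (rule tri_embedding_extend_T3; (elim insertE emptyE)?;
        use assms in \<open>auto simp: strip_def tri_adj_def\<close>)
  have c: "tri_embedding (pos n) (graph_c n)
      (strip (\<lambda>j. if j = 3 then 1 else 0) (\<lambda>j. if j = 1 then int n else int n + 1))"
    unfolding graph_c_def
    by (rule tri_embedding_extend_T3; (elim insertE emptyE)?;
        use assms in \<open>auto simp: strip_def tri_adj_def\<close>)
  \<comment> \<open>A trapezoid with rows of \<open>n\<close>, \<open>n + 1\<close> and
    \<open>n + 2\<close> vertices; \<open>l j + h j = n + j\<close> is the symmetry that the
    reflection needs.\<close>
  have d: "tri_embedding (pos n) (graph_d n) (strip (\<lambda>_. 1) (\<lambda>j. int n + j - 1))"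
    unfolding graph_d_def
    by (rule tri_embedding_extend_T3; (elim insertE emptyE)?;
        use assms in \<open>auto simp: strip_def tri_adj_def\<close>)
  have e: "tri_embedding (pos n) (graph_e n)
      (strip (\<lambda>_. 1) (\<lambda>j. if j = 3 then int n + 1 else int n))"
    unfolding graph_e_def
    by (rule tri_embedding_extend_T3; (elim insertE emptyE)?;
        use assms in \<open>auto simp: strip_def tri_adj_def\<close>)
  have f: "tri_embedding (pos n) (graph_f n)
      (strip (\<lambda>_. 1) (\<lambda>j. if j = 1 then int n else int n + 1))"
    unfolding graph_f_def
    by (rule tri_embedding_extend_T3; (elim insertE emptyE)?;
        use assms in \<open>auto simp: strip_def tri_adj_def\<close>)
  show "snort_first_player_win (T3 n)"
    using assms by (rule_tac rotation_first_player_win[OF tri_embedding_T3]) auto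
  \<comment> \<open>Since \<open>h 2 = h 1 + 1\<close> and \<open>l 2 = 1\<close>, the bounds on
    rows 1 and 2 force \<open>t = n + 2 - k\<close> and \<open>k \<le> t \<le> k + 1\<close>, so the
    parity of \<open>n\<close> determines both values.\<close>
  show "snort_first_player_win (graph_a n)"
  proof (cases "even n")
    case True
    then obtain m where "n = 2 * m" ..
    then show ?thesis
      using assms
      by (rule_tac translation_first_player_win[OF a, where k = "int m + 1" and t = "int m + 1"]) auto
  next
    case False
    then obtain m where "n = 2 * m + 1"
      using oddE by blast
    then show ?thesis
      by (rule_tac translation_first_player_win[OF a, where k = "int m + 1" and t = "int m + 2"]) auto
  qed
  show "snort_first_player_win (graph_b n)"
    using assms by (rule_tac rotation_first_player_win[OF b, where s = "int n + 1"]) auto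
  show "snort_first_player_win (graph_c n)"
    by (rule rotation_first_player_win[OF c, where s = "int n + 1"]) auto
  show "snort_first_player_win (graph_d n)"
    by (rule reflection_first_player_win[OF d, where s = "int n"]) auto
  show "snort_first_player_win (graph_e n)"
  proof (cases "even n")
    case True
    then obtain m where "n = 2 * m" ..
    then show ?thesis
      using assms
      by (rule_tac translation_first_player_win[OF e, where k = "int m + 1" and t = "int m + 1"]) auto
  next
    case False
    then obtain m where m: "n = 2 * m + 1"
      using oddE by blast
    show ?thesis
    proof (cases "m = 0")
      \<comment> \<open>Here \<open>t = m + 1\<close> would be 1, too short a translation; but
        \<open>(1, 2)\<close> is adjacent to all three other vertices, so the opponent has no
        reply.\<close>
      case True
      show ?thesis
        using m True
        by (rule_tac tri_pairing_first_player_win[OF e, where u = "(1, 2)" and D = "{}"])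
          (auto simp: strip_def tri_adj_def)
    next
      case False
      then show ?thesis
        using m
        by (rule_tac translation_first_player_win[OF e, where k = "int m + 1" and t = "int m + 1"]) auto
    qed
  qed
  show "snort_first_player_win (graph_f n)" if "even n"
  proof -
    \<comment> \<open>Rows 1 and 2 force the same values as in (a). For \<open>n = 2 * m + 1\<close>
      these would be \<open>k = m + 1\<close> and \<open>t = m + 2\<close>, and then
      \<open>k + 1 - t = 0\<close> is below \<open>l 1 = 1\<close>; for even \<open>n\<close> the
      two sides agree.\<close>
    obtain m where "n = 2 * m"
      using \<open>even n\<close> by blast
    then show ?thesis
      using assms
      by (rule_tac translation_first_player_win[OF f, where k = "int m + 1" and t = "int m + 1"]) auto
  qed
qed

end
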